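(* For every integer $i \geq 0$, $\chi_{\bar{2}}(9 \cdot 2^{i}-1) \leq 13\cdot 2^i$.
   Context: $\chi_{\bar{2}}(n)$ denotes the chromatic number of the graph $Q_n^2$, whose vertex set is $\mathbb{Z}_2^n$ (binary words of length $n$) and in which two distinct words are adjacent exactly when their Hamming distance is at most $2$ (the square of the $n$-dimensional hypercube). *)

theory Defs
  imports Main "HOL-Library.Z2"
begin

definition proper_colouring :: "'a set \<Rightarrow> ('a \<Rightarrow> 'a \<Rightarrow> bool) \<Rightarrow> ('a \<Rightarrow> 'c) \<Rightarrow> bool" where
  "proper_colouring V adj c \<longleftrightarrow> (\<forall>x\<in>V. \<forall>y\<in>V. adj x y \<longrightarrow> c x \<noteq> c y)"

text \<open>
  The least number of colours in a proper colouring. It is meaningful only if some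
  finite number of colours suffices, e.g. if the vertex set is finite and the
  adjacency relation irreflexive; otherwise \<open>LEAST\<close> is unspecified.
\<close>
definition chromatic_number :: "'a set \<Rightarrow> ('a \<Rightarrow> 'a \<Rightarrow> bool) \<Rightarrow> nat" where
  "chromatic_number V adj =
     (LEAST k. \<exists>c :: 'a \<Rightarrow> nat. c ` V \<subseteq> {..<k} \<and> proper_colouring V adj c)"

definition words :: "nat \<Rightarrow> bit list set" where
  "words n = {w. length w = n}"

text \<open>Intended for words of equal length only.\<close>
definition hamming_dist :: "'a list \<Rightarrow> 'a list \<Rightarrow> nat" where
  "hamming_dist x y = card {i. i < length x \<and> x ! i \<noteq> y ! i}"

definition cube_square_adj :: "bit list \<Rightarrow> bit list \<Rightarrow> bool" where
  "cube_square_adj x y \<longleftrightarrow> x \<noteq> y \<and> hamming_dist x y \<le> 2"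

definition chi2 :: "nat \<Rightarrow> nat" where
  "chi2 n = chromatic_number (words n) cube_square_adj"

lemma finite_words: "finite (words n)"
proof -
  have "finite (UNIV :: bit set)"
    by (rule finite_subset[of _ "{0, 1}"]) (use bit_not_zero_iff in blast, simp)
  from finite_lists_length_eq[OF this, of n] show ?thesis
    by (simp add: words_def)
qed

text \<open>The minimum defining \<open>chi2 n\<close> is attained, so it is a genuine chromatic number.\<close>
lemma chi2_attained:
  "\<exists>c :: bit list \<Rightarrow> nat. c ` words n \<subseteq> {..<chi2 n} \<and> proper_colouring (words n) cube_square_adj c"
proof -
  obtain f :: "bit list \<Rightarrow> nat" where f: "bij_betw f (words n) {0..<card (words n)}"
    using ex_bij_betw_finite_nat[OF finite_words] by blast
  have "f ` words n \<subseteq> {..<card (words n)}"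
    using f by (auto simp: bij_betw_def)
  moreover have "proper_colouring (words n) cube_square_adj f"
    using f by (auto simp: proper_colouring_def cube_square_adj_def bij_betw_def inj_on_def)
  ultimately have "\<exists>k. \<exists>c :: bit list \<Rightarrow> nat. c ` words n \<subseteq> {..<k} \<and>
      proper_colouring (words n) cube_square_adj c"
    by blast
  then show ?thesis
    unfolding chi2_def chromatic_number_def by (rule LeastI_ex)
qed

end

theory Submission
  imports Defs
begin

text \<open>
  If \<open>c\<close> is a proper colouring of \<open>Q\<^sub>n\<^sup>2\<close>, then colouring the word \<open>(b, x, y)\<close>, where
  \<open>x\<close> and \<open>y\<close> have length \<open>n\<close>, by the pair of \<open>c (x + y)\<close> and the parity of \<open>(b, x)\<close> is a proper
  colouring of \<open>Q\<^sub>2\<^sub>n\<^sub>+\<^sub>1\<^sup>2\<close>: if two words at distance at most 2 share the first component, then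
  \<open>x + y = x' + y'\<close>, so \<open>x\<close> and \<open>y\<close> change in the same positions; hence either only \<open>b\<close> changes, or
  exactly one letter of each of \<open>x\<close> and \<open>y\<close>, and both flip the parity. This doubles the number of
  colours, and \<open>n = 9 \<cdot> 2\<^sup>i - 1\<close> is sent to \<open>2 n + 1 = 9 \<cdot> 2\<^sup>i\<^sup>+\<^sup>1 - 1\<close>. It remains to exhibit a
  13-colouring of \<open>Q\<^sub>8\<^sup>2\<close>.
\<close>

section \<open>Hamming distance\<close>

text \<open>As a simp rule it turns \<open>+\<close> on bits into \<open>XOR\<close>, where lemmas
  on group sums no longer apply.\<close>

declare add_bit_eq_xor [simp del]

lemma hamming_dist_Nil [simp]: "hamming_dist [] ys = 0"
  by (simp add: hamming_dist_def)

lemma hamming_dist_Cons [simp]: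
  "hamming_dist (x # xs) (y # ys) = of_bool (x \<noteq> y) + hamming_dist xs ys"
proof -
  have "{i. i < length (x # xs) \<and> (x # xs) ! i \<noteq> (y # ys) ! i} =
      (if x \<noteq> y then {0} else {}) \<union> Suc ` {i. i < length xs \<and> xs ! i \<noteq> ys ! i}"
    (is "?A = ?B \<union> Suc ` ?C")
    by (auto simp: less_Suc_eq_0_disj)
  moreover have "card (?B \<union> Suc ` ?C) = card ?B + card (Suc ` ?C)"
    by (intro card_Un_disjoint) auto
  ultimately show ?thesis
    by (simp add: hamming_dist_def card_image)
qed

lemma hamming_dist_append:
  assumes "length xs = length xs'"
  shows "hamming_dist (xs @ ys) (xs' @ ys') = hamming_dist xs xs' + hamming_dist ys ys'"
  using assms by (induction xs xs' rule: list_induct2) auto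

lemma hamming_dist_eq_0_iff:
  assumes "length xs = length ys"
  shows "hamming_dist xs ys = 0 \<longleftrightarrow> xs = ys"
  using assms by (induction xs ys rule: list_induct2) auto

lemma hamming_dist_map2_plus_le:
  fixes x y x' y' :: "'a :: group_add list"
  assumes "length x = length y" "length y = length x'" "length x' = length y'"
  shows "hamming_dist (map2 (+) x y) (map2 (+) x' y') \<le> hamming_dist x x' + hamming_dist y y'"
  using assms by (induction x y x' y' rule: list_induct4) auto

text \<open>By cancellation, the letters of \<open>x\<close> and \<open>x'\<close> agree exactly
  where those of \<open>y\<close> and \<open>y'\<close> do.\<close>

lemma hamming_dist_eq_if_map2_plus_eq:
  fixes x y x' y' :: "'a :: group_add list"
  assumes "length x = length y" "length y = length x'" "length x' = length y'"
    and "map2 (+) x y = map2 (+) x' y'"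
  shows "hamming_dist x x' = hamming_dist y y'"
  using assms by (induction x y x' y' rule: list_induct4) auto

lemma sum_list_plus_sum_list_bit:
  fixes x y :: "bit list"
  assumes "length x = length y"
  shows "sum_list x + sum_list y = of_nat (hamming_dist x y)"
  using assms
proof (induction x y rule: list_induct2)
  case (Cons a x b y)
  have "sum_list (a # x) + sum_list (b # y) = (a + b) + (sum_list x + sum_list y)"
    by (simp add: algebra_simps)
  also have "a + b = of_bool (a \<noteq> b)"
    by (cases a; cases b) auto
  finally show ?case
    using Cons by simp
qed simp

section \<open>Doubling the dimension\<close>

lemma chi2_leI:
  assumes "c ` words n \<subseteq> {..<k}" "proper_colouring (words n) cube_square_adj c"
  shows "chi2 n \<le> k"
  unfolding chi2_def chromatic_number_def using assms by (intro Least_le) blast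

definition double_colouring :: "nat \<Rightarrow> (bit list \<Rightarrow> nat) \<Rightarrow> bit list \<Rightarrow> nat" where
  "double_colouring n c w =
     2 * c (map2 (+) (take n (tl w)) (drop n (tl w))) +
     of_bool (hd w + sum_list (take n (tl w)) \<noteq> 0)"

lemma double_plus_of_bool_eq_iff:
  fixes p q :: nat
  shows "2 * p + of_bool P = 2 * q + of_bool Q \<longleftrightarrow> p = q \<and> P = Q"
  by (cases P; cases Q; simp; presburger)

lemma double_colouring_Cons_append:
  "length x = n \<Longrightarrow> double_colouring n c (b # x @ y) =
     2 * c (map2 (+) x y) + of_bool (sum_list (b # x) \<noteq> 0)"
  by (simp add: double_colouring_def)

lemma words_double_cases:
  assumes "w \<in> words (Suc (2 * n))"
  obtains b x y where "w = b # x @ y" "length x = n" "length y = n"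
proof -
  obtain b v where w: "w = b # v" "length v = 2 * n"
    using assms by (cases w) (auto simp: words_def)
  then show thesis
    by (intro that[of b "take n v" "drop n v"]) auto
qed

lemma double_colouring_less:
  assumes "c ` words n \<subseteq> {..<k}" "w \<in> words (Suc (2 * n))"
  shows "double_colouring n c w < 2 * k"
proof -
  obtain b x y where w: "w = b # x @ y" "length x = n" "length y = n"
    using assms(2) by (rule words_double_cases)
  have "map2 (+) x y \<in> words n"
    using w by (simp add: words_def)
  then have "c (map2 (+) x y) < k"
    using assms(1) by blast
  then show ?thesis
    using w by (simp add: double_colouring_Cons_append of_bool_def)
qed

lemma proper_double_colouring:
  assumes c: "proper_colouring (words n) cube_square_adj c"
  shows "proper_colouring (words (Suc (2 * n))) cube_square_adj (double_colouring n c)"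
  unfolding proper_colouring_def
proof (intro ballI impI notI)
  fix w w'
  assume w: "w \<in> words (Suc (2 * n))" and w': "w' \<in> words (Suc (2 * n))"
    and adj: "cube_square_adj w w'"
    and eq: "double_colouring n c w = double_colouring n c w'"
  obtain b x y where W: "w = b # x @ y" and len: "length x = n" "length y = n"
    using w by (rule words_double_cases)
  obtain b' x' y' where W': "w' = b' # x' @ y'" and len': "length x' = n" "length y' = n"
    using w' by (rule words_double_cases)
  have dist: "of_bool (b \<noteq> b') + hamming_dist x x' + hamming_dist y y' \<le> 2"
    using adj len len' by (simp add: cube_square_adj_def W W' hamming_dist_append)
  have colour: "c (map2 (+) x y) = c (map2 (+) x' y')"
    "sum_list (b # x) \<noteq> 0 \<longleftrightarrow> sum_list (b' # x') \<noteq> 0"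
    using eq len len'
    by (simp_all only: W W' double_colouring_Cons_append double_plus_of_bool_eq_iff)
  have "hamming_dist (map2 (+) x y) (map2 (+) x' y') \<le> 2"
    using hamming_dist_map2_plus_le[of x y x' y'] dist len len' by simp
  moreover have "map2 (+) x y \<in> words n" "map2 (+) x' y' \<in> words n"
    using len len' by (simp_all add: words_def)
  ultimately have "map2 (+) x y = map2 (+) x' y'"
    using c colour(1) unfolding proper_colouring_def cube_square_adj_def by blast
  then have same: "hamming_dist x x' = hamming_dist y y'"
    using len len' by (intro hamming_dist_eq_if_map2_plus_eq) auto
  have "sum_list (b # x) = sum_list (b' # x')"
    using colour(2) by (metis bit_not_zero_iff)
  then have "of_bool (b \<noteq> b') + of_nat (hamming_dist x x') = (0 :: bit)"
    using sum_list_plus_sum_list_bit[of "b # x" "b' # x'"] len len' by simp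
  \<comment> \<open>By \<open>same\<close>, the distance is \<open>of_bool (b \<noteq> b')\<close>
    plus twice \<open>hamming_dist x x'\<close>.\<close>
  moreover have "hamming_dist x x' = 0 \<or> hamming_dist x x' = 1 \<and> b = b'"
    using dist same by (cases "b = b'") auto
  ultimately have "b = b' \<and> hamming_dist x x' = 0"
    by auto
  then have "w = w'"
    using same len len' hamming_dist_eq_0_iff[of x x'] hamming_dist_eq_0_iff[of y y']
    by (simp add: W W')
  then show False
    using adj by (simp add: cube_square_adj_def)
qed

lemma chi2_double: "chi2 (Suc (2 * n)) \<le> 2 * chi2 n"
proof -
  obtain c where c: "c ` words n \<subseteq> {..<chi2 n}" "proper_colouring (words n) cube_square_adj c"
    using chi2_attained by blast
  show ?thesis
    using double_colouring_less[OF c(1)] proper_double_colouring[OF c(2)]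
    by (intro chi2_leI[of "double_colouring n c"]) auto
qed

section \<open>Colourings given by tables\<close>

text \<open>With the table as a binary tree, colours are compared by recursion on pairs of subtrees,
  which drops pairs of words too far apart early.\<close>

datatype 'a tree = Leaf 'a | Node "'a tree" "'a tree"

fun tree_of :: "nat \<Rightarrow> 'a list \<Rightarrow> 'a tree" where
  "tree_of 0 xs = Leaf (hd xs)"
| "tree_of (Suc n) xs = Node (tree_of n (take (2 ^ n) xs)) (tree_of n (drop (2 ^ n) xs))"

fun lookup :: "'a tree \<Rightarrow> bit list \<Rightarrow> 'a" where
  "lookup (Leaf a) _ = a"
| "lookup (Node l r) [] = lookup l []"
| "lookup (Node l r) (b # w) = lookup (if b = 0 then l else r) w"

text \<open>
  The bound in \<open>self_separated d\<close> is off by one: it concerns distinct words at distance at most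
  \<open>d + 1\<close>, since the first letter in which they differ has already used up one unit.
\<close>

fun separated :: "nat \<Rightarrow> 'a tree \<Rightarrow> 'a tree \<Rightarrow> bool" where
  "separated d (Leaf a) (Leaf b) \<longleftrightarrow> a \<noteq> b"
| "separated 0 (Node l r) (Node l' r') \<longleftrightarrow> separated 0 l l' \<and> separated 0 r r'"
| "separated (Suc d) (Node l r) (Node l' r') \<longleftrightarrow>
     separated (Suc d) l l' \<and> separated (Suc d) r r' \<and> separated d l r' \<and> separated d r l'"
| "separated d _ _ \<longleftrightarrow> False"

fun self_separated :: "nat \<Rightarrow> 'a tree \<Rightarrow> bool" where
  "self_separated d (Leaf a) \<longleftrightarrow> True"
| "self_separated d (Node l r) \<longleftrightarrow>
     self_separated d l \<and> self_separated d r \<and> separated d l r"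

lemma lookup_tree_of_in_set:
  assumes "length xs = 2 ^ n"
  shows "lookup (tree_of n xs) w \<in> set xs"
  using assms
proof (induction n arbitrary: xs w)
  case 0
  then show ?case
    by (cases xs) auto
next
  case (Suc n)
  have "lookup (tree_of n (take (2 ^ n) xs)) u \<in> set xs"
    "lookup (tree_of n (drop (2 ^ n) xs)) u \<in> set xs" for u
    using Suc.IH[of "take (2 ^ n) xs" u] Suc.IH[of "drop (2 ^ n) xs" u] Suc.prems
    by (auto dest: in_set_takeD in_set_dropD)
  then show ?case
    by (cases w) auto
qed

lemma separated_commute: "separated d s t \<longleftrightarrow> separated d t s"
  by (induction d s t rule: separated.induct) auto

lemma separated_lookup:
  assumes "separated d s t" "length v = length w" "hamming_dist v w \<le> d"
  shows "lookup s v \<noteq> lookup t w"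
  using assms
proof (induction d s t arbitrary: v w rule: separated.induct)
  case (2 l r l' r')
  then show ?case
    by (cases v; cases w) (auto split: if_splits)
next
  case (3 d l r l' r')
  then show ?case
    by (cases v; cases w) (auto split: if_splits)
qed auto

lemma self_separated_lookup:
  assumes "self_separated d (tree_of n xs)" "length v = n" "length w = n"
    and "v \<noteq> w" "hamming_dist v w \<le> Suc d"
  shows "lookup (tree_of n xs) v \<noteq> lookup (tree_of n xs) w"
  using assms
proof (induction n arbitrary: xs v w)
  case (Suc n)
  obtain a v' b w' where vw: "v = a # v'" "w = b # w'"
    using Suc.prems(2,3) by (metis length_Suc_conv)
  show ?case
  proof (cases "a = b")
    case True
    with Suc vw show ?thesis
      by (auto split: if_splits)
  next
    case False
    let ?l = "tree_of n (take (2 ^ n) xs)" and ?r = "tree_of n (drop (2 ^ n) xs)"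
    have dist: "length v' = length w'" "hamming_dist v' w' \<le> d"
      using False Suc.prems vw by auto
    have "separated d ?l ?r"
      using Suc.prems(1) by simp
    \<comment> \<open>\<open>self_separated\<close> tests the two subtrees in one order only;
      symmetry gives the other.\<close>
    then have "lookup ?l v' \<noteq> lookup ?r w'" "lookup ?r v' \<noteq> lookup ?l w'"
      using separated_lookup[OF _ dist] separated_commute by blast+
    with False show ?thesis
      unfolding vw by (cases a; cases b) simp_all
  qed
qed simp

text \<open>
  Entry \<open>i\<close> is the colour of the binary expansion of \<open>i\<close>. The table was found by a computer search
  restricted to colourings with a symmetry of order 6 that permutes the colours in two cycles of
  length 6 and fixes one; it acts on \<open>Q\<^sub>8\<^sup>2\<close> viewed as the graph of even words of length 9 at
  distance 2.
\<close>

definition table8 :: "nat list" where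
  "table8 = [
     8, 12, 5, 4, 9, 11, 1, 2, 11, 10, 12, 9, 0, 7, 4, 3,
     3, 0, 2, 6, 4, 10, 8, 9, 6, 4, 7, 8, 2, 5, 10, 0,
     7, 6, 9, 0, 2, 3, 10, 5, 4, 1, 3, 11, 5, 9, 7, 8,
     10, 8, 1, 12, 11, 7, 3, 4, 9, 3, 5, 2, 8, 12, 6, 1,
     4, 3, 7, 1, 10, 5, 3, 0, 9, 8, 10, 6, 6, 2, 5, 11,
     5, 11, 9, 10, 7, 8, 6, 12, 0, 1, 11, 5, 12, 3, 1, 4,
     11, 10, 6, 8, 8, 4, 12, 9, 12, 5, 1, 4, 3, 0, 2, 10,
     2, 9, 4, 3, 0, 1, 5, 2, 7, 6, 8, 0, 10, 11, 9, 7,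
     10, 9, 11, 3, 7, 8, 6, 10, 5, 6, 1, 0, 3, 4, 2, 5,
     12, 2, 4, 1, 0, 3, 5, 7, 8, 7, 9, 11, 11, 1, 12, 6,
     3, 4, 8, 2, 12, 0, 4, 1, 2, 8, 6, 7, 10, 11, 9, 12,
     6, 11, 7, 9, 9, 5, 2, 8, 1, 0, 10, 4, 7, 2, 0, 3,
     6, 0, 2, 5, 11, 12, 9, 4, 7, 11, 4, 12, 8, 10, 0, 1,
     1, 4, 0, 8, 2, 6, 10, 11, 10, 9, 6, 3, 5, 0, 7, 2,
     9, 1, 10, 11, 5, 2, 7, 3, 0, 3, 5, 9, 1, 7, 11, 6,
     8, 7, 12, 6, 3, 10, 1, 0, 11, 12, 2, 1, 6, 8, 4, 5]"

text \<open>Parameter 1 covers distance 2, and evaluation settles the check.\<close>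

lemma self_separated_table8: "self_separated 1 (tree_of 8 table8)"
  by code_simp

lemma set_table8: "set table8 \<subseteq> {..<13}"
  by (simp add: table8_def)

lemma length_table8: "length table8 = 2 ^ 8"
  by (simp add: table8_def)

lemma chi2_8: "chi2 8 \<le> 13"
proof (rule chi2_leI)
  show "lookup (tree_of 8 table8) ` words 8 \<subseteq> {..<13}"
    using lookup_tree_of_in_set[OF length_table8] set_table8 by blast
  show "proper_colouring (words 8) cube_square_adj (lookup (tree_of 8 table8))"
    using self_separated_lookup[OF self_separated_table8]
    by (auto simp: proper_colouring_def cube_square_adj_def words_def)
qed

theorem theorem5:
  fixes i :: nat
  shows "chi2 (9 * 2 ^ i - 1) \<le> 13 * 2 ^ i"
proof (induction i)
  case 0
  then show ?case
    using chi2_8 by simp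
next
  case (Suc i)
  \<comment> \<open>This keeps the truncated subtraction in \<open>9 * 2 ^ i - 1\<close>
    exact.\<close>
  have "(1 :: nat) \<le> 2 ^ i"
    by simp
  then have "9 * 2 ^ Suc i - 1 = Suc (2 * (9 * 2 ^ i - 1))"
    unfolding power_Suc by linarith
  then show ?case
    using chi2_double[of "9 * 2 ^ i - 1"] Suc by simp
qed

end
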